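(* Let $S$ be a right reversible semitopological semigroup such that $\operatorname{LUC}(S)$ has a left invariant mean. Let $(X,Q)$ be a Fréchet space with a $Q$-admissible locally convex topology $\tau$. Let $K$ be a nonempty, $\tau$-compact, convex and $Q$-separable subset of $X$. Then every super asymptotically uniformly $Q$-nonexpansive and jointly $\tau$-continuous action of $S$ on $K$ has a common fixed point, i.e. there is $x_0\in K$ with $s.x_0=x_0$ for all $s\in S$.
   Context: A semitopological semigroup is a semigroup $S$ with a Hausdorff topology such that for each fixed $t\in S$ the maps $s\mapsto ts$ and $s\mapsto st$ are continuous. A left ideal is a nonempty subset $I\subseteq S$ with $SI\subseteq I$. $S$ is right reversible if any two closed left ideals of $S$ intersect. $\operatorname{CB}(S)$ is the Banach space of bounded continuous real-valued functions on $S$ with the supremum norm. For $s\in S$, $(l_sf)(t)=f(st)$. $\operatorname{LUC}(S)$ is the space of all $f\in \operatorname{CB}(S)$ for which $s\mapsto l_sf$ from $S$ into $\operatorname{CB}(S)$ is norm continuous. A left invariant mean on $\operatorname{LUC}(S)$ is a functional $m\in \operatorname{LUC}(S)^*$ with $\|m\|=m(1)=1$ and $m(l_sf)=m(f)$ for all $s\in S$, $f\in\operatorname{LUC}(S)$. Locally convex topologies are Hausdorff. A Fréchet space $(X,Q)$ is a complete metrizable locally convex space $X$ together with a countable family $Q=\{q_n:n\in\mathbb N\}$ of seminorms defining its metric topology (the $Q$-topology). A locally convex topology $\tau$ on $X$ is $Q$-admissible if $\tau$ is weaker than the $Q$-topology and every $q_n\in Q$ is $\tau$-lower semicontinuous.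 $Q$-separable means separable in the $Q$-topology. An action of $S$ on $K$ is a map $S\times K\to K$, $(s,x)\mapsto s.x$, with $(st).x=s.(t.x)$; it is jointly $\tau$-continuous if this map is jointly continuous when $K$ carries the topology $\tau$. It is super asymptotically uniformly $Q$-nonexpansive if for all $x\in K$ and $t\in S$ there is a left ideal $I_x^t$ of $S$ such that $q(st.x-st.y)\le q(x-y)$ for all $s\in I_x^t$, all $y\in K$ and all $q\in Q$. *)

theory Defs
  imports "HOL-Analysis.Analysis"
begin

section \<open>Semitopological semigroups\<close>

class semitopological_semigroup = semigroup_mult + t2_space +
  assumes open_vimage_mult_left: "open U \<Longrightarrow> open ((\<lambda>s. t * s) -` U)"
    and open_vimage_mult_right: "open U \<Longrightarrow> open ((\<lambda>s. s * t) -` U)"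

lemma continuous_mult_left:
  fixes t :: "'s::semitopological_semigroup"
  shows "continuous_on UNIV (\<lambda>s. t * s)"
  by (simp add: continuous_on_open_vimage open_vimage_mult_left)

lemma continuous_mult_right:
  fixes t :: "'s::semitopological_semigroup"
  shows "continuous_on UNIV (\<lambda>s. s * t)"
  by (simp add: continuous_on_open_vimage open_vimage_mult_right)

definition left_ideal :: "'s::semigroup_mult set \<Rightarrow> bool" where
  "left_ideal I \<longleftrightarrow> I \<noteq> {} \<and> (\<forall>s. \<forall>t\<in>I. s * t \<in> I)"

definition right_reversible :: "'s::semitopological_semigroup itself \<Rightarrow> bool" where
  "right_reversible _ \<longleftrightarrow>
     (\<forall>I J :: 's set. left_ideal I \<and> closed I \<and> left_ideal J \<and> closed J \<longrightarrow> I \<inter> J \<noteq> {})"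


section \<open>Left uniformly continuous functions and invariant means\<close>

definition left_translate ::
    "'s::semitopological_semigroup \<Rightarrow> ('s \<Rightarrow>\<^sub>C real) \<Rightarrow> ('s \<Rightarrow>\<^sub>C real)" where
  "left_translate s f = Bcontfun (\<lambda>t. f (s * t))"

lemma apply_left_translate: "apply_bcontfun (left_translate s f) t = f (s * t)"
proof -
  have "continuous_on UNIV (\<lambda>t. f (s * t))"
    by (rule continuous_on_compose2[OF continuous_on_apply_bcontfun[of UNIV f] continuous_mult_left]) simp
  moreover have "bounded (range (\<lambda>t. f (s * t)))"
    by (rule bounded_subset[OF bounded_apply_bcontfun[of f]]) auto
  ultimately have "(\<lambda>t. f (s * t)) \<in> bcontfun"
    by (simp add: bcontfun_def)
  then show ?thesis
    by (simp add: left_translate_def Bcontfun_inverse)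
qed

definition LUC :: "('s::semitopological_semigroup \<Rightarrow>\<^sub>C real) set" where
  "LUC = {f. continuous_on UNIV (\<lambda>s. left_translate s f)}"

text \<open>
  A functional on a linear subspace \<open>V\<close> is represented by a total function of which only the
  values on \<open>V\<close> matter.  The supremum in \<open>functional_norm\<close> is meaningful because it is only
  used together with \<open>bounded_functional_on\<close>.
\<close>

definition bounded_functional_on :: "'v::real_normed_vector set \<Rightarrow> ('v \<Rightarrow> real) \<Rightarrow> bool" where
  "bounded_functional_on V m \<longleftrightarrow>
     (\<forall>f\<in>V. \<forall>g\<in>V. m (f + g) = m f + m g) \<and>
     (\<forall>c. \<forall>f\<in>V. m (c *\<^sub>R f) = c * m f) \<and>
     (\<exists>C. \<forall>f\<in>V. \<bar>m f\<bar> \<le> C * norm f)"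

definition functional_norm :: "'v::real_normed_vector set \<Rightarrow> ('v \<Rightarrow> real) \<Rightarrow> real" where
  "functional_norm V m = (SUP f\<in>{f\<in>V. norm f \<le> 1}. \<bar>m f\<bar>)"

definition left_invariant_mean ::
    "(('s::semitopological_semigroup \<Rightarrow>\<^sub>C real) \<Rightarrow> real) \<Rightarrow> bool" where
  "left_invariant_mean m \<longleftrightarrow>
     bounded_functional_on LUC m \<and> functional_norm LUC m = 1 \<and> m (const_bcontfun 1) = 1 \<and>
     (\<forall>s. \<forall>f\<in>LUC. m (left_translate s f) = m f)"


section \<open>Frechet spaces and admissible topologies\<close>

definition seminorm :: "('x::real_vector \<Rightarrow> real) \<Rightarrow> bool" where
  "seminorm p \<longleftrightarrow> (\<forall>x y. p (x + y) \<le> p x + p y) \<and> (\<forall>c x. p (c *\<^sub>R x) = \<bar>c\<bar> * p x)"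

definition seminorm_topology :: "(nat \<Rightarrow> 'x::real_vector \<Rightarrow> real) \<Rightarrow> 'x topology" where
  "seminorm_topology q = topology_generated_by {{y. q n (y - x) < r} | n x r. r > 0}"

definition locally_convex_topology :: "'x::real_vector topology \<Rightarrow> bool" where
  "locally_convex_topology T \<longleftrightarrow>
     topspace T = UNIV \<and> Hausdorff_space T \<and>
     continuous_map (prod_topology T T) T (\<lambda>(x, y). x + y) \<and>
     continuous_map (prod_topology euclideanreal T) T (\<lambda>(c, x). c *\<^sub>R x) \<and>
     neighbourhood_base_at 0 convex T"

text \<open>
  Completeness refers to the uniformity of the vector space, that is, to a translation-invariant
  metric inducing the topology; the family of seminorms is indexed by the natural numbers,
  possibly with repetitions.
\<close>

definition frechet_space :: "(nat \<Rightarrow> 'x::real_vector \<Rightarrow> real) \<Rightarrow> bool" where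
  "frechet_space q \<longleftrightarrow>
     (\<forall>n. seminorm (q n)) \<and> locally_convex_topology (seminorm_topology q) \<and>
     (\<exists>d. Metric_space UNIV d \<and> (\<forall>x y z. d (x + z) (y + z) = d x y) \<and>
          Metric_space.mcomplete UNIV d \<and> Metric_space.mtopology UNIV d = seminorm_topology q)"

definition lower_semicontinuous_map :: "'x topology \<Rightarrow> ('x \<Rightarrow> real) \<Rightarrow> bool" where
  "lower_semicontinuous_map T f \<longleftrightarrow> (\<forall>a. openin T {x \<in> topspace T. a < f x})"

definition admissible_topology ::
    "(nat \<Rightarrow> 'x::real_vector \<Rightarrow> real) \<Rightarrow> 'x topology \<Rightarrow> bool" where
  "admissible_topology q T \<longleftrightarrow>
     locally_convex_topology T \<and>
     (\<forall>U. openin T U \<longrightarrow> openin (seminorm_topology q) U) \<and>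
     (\<forall>n. lower_semicontinuous_map T (q n))"


section \<open>Actions\<close>

definition semigroup_action_on :: "'x set \<Rightarrow> ('s::semigroup_mult \<Rightarrow> 'x \<Rightarrow> 'x) \<Rightarrow> bool" where
  "semigroup_action_on K act \<longleftrightarrow>
     (\<forall>s. \<forall>x\<in>K. act s x \<in> K) \<and> (\<forall>s t. \<forall>x\<in>K. act (s * t) x = act s (act t x))"

definition jointly_continuous_action ::
    "'x topology \<Rightarrow> 'x set \<Rightarrow> ('s::topological_space \<Rightarrow> 'x \<Rightarrow> 'x) \<Rightarrow> bool" where
  "jointly_continuous_action T K act \<longleftrightarrow>
     continuous_map (prod_topology euclidean (subtopology T K)) (subtopology T K)
       (\<lambda>(s, x). act s x)"

definition super_asymptotically_uniformly_nonexpansive ::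
    "(nat \<Rightarrow> 'x::real_vector \<Rightarrow> real) \<Rightarrow> 'x set \<Rightarrow> ('s::semigroup_mult \<Rightarrow> 'x \<Rightarrow> 'x) \<Rightarrow> bool" where
  "super_asymptotically_uniformly_nonexpansive q K act \<longleftrightarrow>
     (\<forall>x\<in>K. \<forall>t. \<exists>I. left_ideal I \<and>
        (\<forall>s\<in>I. \<forall>y\<in>K. \<forall>n. q n (act (s * t) x - act (s * t) y) \<le> q n (x - y)))"

end

theory Submission
  imports Defs
begin

text \<open>
  Call the \<open>\<tau>\<close>-limit points of \<open>s.x\<close>, as \<open>s\<close> runs through smaller and smaller left ideals, the limit
  set of \<open>x\<close>; right reversibility makes it nonempty, and it is invariant. By Zorn there is a minimal
  nonempty closed convex \<open>M \<subseteq> K\<close> that contains the limit sets of its points, and inside a limit set a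
  minimal closed invariant set \<open>F \<subseteq> M\<close>. The mean forces \<open>s.F = F\<close> for all \<open>s\<close>, and separability with
  Baire's theorem makes \<open>F\<close> totally bounded for every seminorm \<open>p\<close> of the family. If \<open>F\<close> had positive
  \<open>p\<close>-diameter, some point of its convex hull would be at distance at most \<open>r < diam F\<close> from all of \<open>F\<close>;
  because \<open>s.F = F\<close> and the action is nonexpansive on a left ideal, the points of \<open>M\<close> with this property
  again contain their limit sets, contradicting minimality. So \<open>F\<close> is a single fixed point.
\<close>

section \<open>Left ideals and positivity of means\<close>

lemma left_ideal_image_mult: "left_ideal J \<Longrightarrow> left_ideal ((\<lambda>j. j * t) ` J)"
  for t :: "'s::semigroup_mult"
  by (auto simp: left_ideal_def simp flip: mult.assoc)

text \<open>Left multiplication by a fixed element is continuous and maps \<open>J\<close> into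
  itself, hence also \<open>closure J\<close>. So right reversibility, which speaks of closed
  ideals, can be applied to closures of arbitrary ones.\<close>

lemma left_ideal_closure:
  fixes J :: "'s::semitopological_semigroup set"
  assumes "left_ideal J"
  shows "left_ideal (closure J)"
proof -
  have "s * t \<in> closure J" if "t \<in> closure J" for s t
  proof -
    have "(*) s ` closure J \<subseteq> closure J"
    proof (rule image_closure_subset)
      show "continuous_on (closure J) ((*) s)"
        by (rule continuous_on_subset[OF continuous_mult_left]) simp
      show "(*) s ` J \<subseteq> closure J"
        using assms closure_subset[of J] by (auto simp: left_ideal_def)
    qed simp
    with that show ?thesis
      by auto
  qed
  with assms show ?thesis
    by (auto simp: left_ideal_def)
qed

text \<open>By induction the intersection stays a closed left ideal, with right reversibility
  supplying its nonemptiness. The empty family yields the whole semigroup.\<close>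

lemma right_reversible_finite_Inter:
  fixes \<J> :: "'s::semitopological_semigroup set set"
  assumes "right_reversible TYPE('s)" "finite \<J>" "\<And>J. J \<in> \<J> \<Longrightarrow> left_ideal J \<and> closed J"
  shows "\<Inter>\<J> \<noteq> {}"
proof -
  have "left_ideal (\<Inter>\<J>) \<and> closed (\<Inter>\<J>)"
    using assms(2,3)
  proof (induction \<J>)
    case empty
    then show ?case by (simp add: left_ideal_def)
  next
    case (insert J \<J>)
    then have "J \<inter> \<Inter>\<J> \<noteq> {}"
      using assms(1) by (simp add: right_reversible_def)
    with insert show ?case
      by (auto simp: left_ideal_def)
  qed
  then show ?thesis
    by (simp add: left_ideal_def)
qed

section \<open>Left uniformly continuous functions and means on them\<close>

lemma left_translate_const: "left_translate s (const_bcontfun c) = const_bcontfun c"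
  by (rule bcontfun_eqI) (simp add: apply_left_translate const_bcontfun.rep_eq)

lemma const_bcontfun_in_LUC: "const_bcontfun c \<in> LUC"
  by (simp add: LUC_def left_translate_const)

lemma left_translate_diff: "left_translate s (f - g) = left_translate s f - left_translate s g"
  by (rule bcontfun_eqI) (simp add: apply_left_translate)

lemma left_translate_scaleR: "left_translate s (c *\<^sub>R f) = c *\<^sub>R left_translate s f"
  by (rule bcontfun_eqI) (simp add: apply_left_translate)

lemma LUC_diff: "f \<in> LUC \<Longrightarrow> g \<in> LUC \<Longrightarrow> f - g \<in> LUC"
  by (simp add: LUC_def left_translate_diff continuous_on_diff)

lemma LUC_scaleR: "f \<in> LUC \<Longrightarrow> c *\<^sub>R f \<in> LUC"
  by (simp add: LUC_def left_translate_scaleR continuous_on_scaleR)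

context
  fixes m :: "('s::semitopological_semigroup \<Rightarrow>\<^sub>C real) \<Rightarrow> real"
  assumes m: "left_invariant_mean m"
begin

lemma mean_add: "f \<in> LUC \<Longrightarrow> g \<in> LUC \<Longrightarrow> m (f + g) = m f + m g"
  and mean_scaleR: "f \<in> LUC \<Longrightarrow> m (c *\<^sub>R f) = c * m f"
  using m by (auto simp: left_invariant_mean_def bounded_functional_on_def)

lemma mean_diff: "f \<in> LUC \<Longrightarrow> g \<in> LUC \<Longrightarrow> m (f - g) = m f - m g"
  using mean_add[of "f - g" g] LUC_diff[of f g] by simp

lemma mean_const: "m (const_bcontfun c) = c"
proof -
  have "const_bcontfun c = c *\<^sub>R (const_bcontfun 1 :: 's \<Rightarrow>\<^sub>C real)"
    by (rule bcontfun_eqI) (simp add: const_bcontfun.rep_eq)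
  then show ?thesis
    using m mean_scaleR[OF const_bcontfun_in_LUC[of 1], of c]
    by (simp add: left_invariant_mean_def)
qed

lemma abs_mean_le_norm:
  assumes "f \<in> LUC"
  shows "\<bar>m f\<bar> \<le> norm f"
proof (cases "f = 0")
  case True
  then show ?thesis
    using mean_const[of 0] by simp
next
  case False
  obtain C where C: "\<And>g. g \<in> LUC \<Longrightarrow> \<bar>m g\<bar> \<le> C * norm g"
    using m unfolding left_invariant_mean_def bounded_functional_on_def by blast
  define g where "g = (1 / norm f) *\<^sub>R f"
  have g: "g \<in> {f \<in> LUC. norm f \<le> 1}"
    using False assms by (simp add: g_def LUC_scaleR)
  \<comment> \<open>A real supremum dominates its members only for families bounded above; the bound
    is \<open>\<bar>C\<bar>\<close> because the sign of \<open>C\<close> is not known.\<close>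
  have "bdd_above ((\<lambda>f. \<bar>m f\<bar>) ` {f \<in> LUC. norm f \<le> 1})"
  proof (rule bdd_aboveI2)
    fix h assume "h \<in> {f \<in> LUC :: ('s \<Rightarrow>\<^sub>C real) set. norm f \<le> 1}"
    then show "\<bar>m h\<bar> \<le> \<bar>C\<bar>"
      using C[of h] mult_mono[of C "\<bar>C\<bar>" "norm h" 1] abs_ge_self[of C] by simp
  qed
  from cSUP_upper[OF g this] have "\<bar>m g\<bar> \<le> functional_norm LUC m"
    by (simp add: functional_norm_def)
  then have "\<bar>m g\<bar> \<le> 1"
    using m by (simp add: left_invariant_mean_def)
  then show ?thesis
    using False assms by (simp add: g_def mean_scaleR abs_mult field_simps)
qed

text \<open>Positivity comes from norm one and value 1 at the constant 1: subtracting a large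
  constant \<open>M\<close> leaves a function of norm at most \<open>M - c\<close>, so
  \<open>m f\<close> differs from \<open>M\<close> by at most \<open>M - c\<close>.\<close>

lemma mean_ge:
  assumes f: "f \<in> LUC" and ge: "\<And>s. c \<le> apply_bcontfun f s"
  shows "c \<le> m f"
proof -
  define M where "M = norm f + \<bar>c\<bar>"
  have "norm (f - const_bcontfun M) \<le> M - c"
  proof (rule norm_bound)
    fix s
    have "apply_bcontfun f s \<le> norm f"
      using norm_bounded[of f s] by simp
    then show "norm (apply_bcontfun (f - const_bcontfun M) s) \<le> M - c"
      using ge[of s] by (simp add: const_bcontfun.rep_eq M_def)
  qed
  moreover have "\<bar>m (f - const_bcontfun M)\<bar> \<le> norm (f - const_bcontfun M)"
    by (rule abs_mean_le_norm) (simp add: LUC_diff f const_bcontfun_in_LUC)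
  ultimately show ?thesis
    by (simp add: mean_diff f const_bcontfun_in_LUC mean_const)
qed

end

section \<open>Continuous actions on compact Hausdorff spaces\<close>

text \<open>Zorn's lemma for maximal elements is applied to complements. A nonempty finite part of a
  chain contains its own intersection, so compactness keeps the intersection of the whole chain
  nonempty.\<close>

lemma compact_space_minimal_closed:
  assumes "compact_space Y" and "P A"
    and closed: "\<And>B. P B \<Longrightarrow> closedin Y B \<and> B \<noteq> {}"
    and Inter: "\<And>\<C>. \<C> \<noteq> {} \<Longrightarrow> (\<And>B. B \<in> \<C> \<Longrightarrow> P B) \<Longrightarrow> \<Inter>\<C> \<noteq> {} \<Longrightarrow> P (\<Inter>\<C>)"
  obtains M where "M \<subseteq> A" "P M" "\<And>N. N \<subseteq> M \<Longrightarrow> P N \<Longrightarrow> N = M"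
proof -
  let ?\<A> = "uminus ` {B. B \<subseteq> A \<and> P B}"
  have "\<exists>M\<in>?\<A>. \<forall>X\<in>?\<A>. M \<subseteq> X \<longrightarrow> X = M"
  proof (rule subset_Zorn_nonempty)
    show "?\<A> \<noteq> {}"
      using \<open>P A\<close> by blast
    fix \<C> assume "\<C> \<noteq> {}" and chain: "subset.chain ?\<A> \<C>"
    let ?\<D> = "uminus ` \<C>"
    have \<D>: "B \<subseteq> A \<and> P B" if "B \<in> ?\<D>" for B
      using that chain by (auto simp: subset.chain_def subset_iff)
    have "C \<subseteq> C' \<or> C' \<subseteq> C" if "C \<in> \<C>" "C' \<in> \<C>" for C C'
      using chain that by (auto simp: subset_chain_def)
    then have cmp: "B \<subseteq> B' \<or> B' \<subseteq> B" if "B \<in> ?\<D>" "B' \<in> ?\<D>" for B B'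
      using that by (metis (no_types, lifting) imageE Compl_subset_Compl_iff)
    have "\<Inter>\<F> \<noteq> {}" if "finite \<F>" "\<F> \<subseteq> ?\<D>" for \<F>
    proof (cases "\<F> = {}")
      case False
      have "subset.chain UNIV \<F>"
        using that(2) cmp by (simp add: subset_chain_def subset_iff)
      with that(1) False have "\<Inter>\<F> \<in> \<F>"
        by (rule Inter_in_chain)
      then show ?thesis
        using that(2) \<D> closed by blast
    qed simp
    then have "\<Inter>?\<D> \<noteq> {}"
      using \<open>compact_space Y\<close> closed \<D> by (simp add: compact_space_fip)
    then have "P (\<Inter>?\<D>)"
      using \<open>\<C> \<noteq> {}\<close> \<D> by (intro Inter) auto
    moreover have "\<Inter>?\<D> \<subseteq> A"
      using \<open>\<C> \<noteq> {}\<close> \<D> by blast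
    moreover have "\<Union>\<C> = - \<Inter>?\<D>"
      by auto
    ultimately show "\<Union>\<C> \<in> ?\<A>"
      by blast
  qed
  then obtain M where M: "M \<subseteq> A" "P M"
    and max: "\<And>N. N \<subseteq> A \<Longrightarrow> P N \<Longrightarrow> - M \<subseteq> - N \<Longrightarrow> - N = - M"
    by auto
  have "N = M" if "N \<subseteq> M" "P N" for N
    using max[of N] that M(1) by auto
  with M that show thesis
    by blast
qed

text \<open>The purely topological half of the argument lives here; it is later applied to
  \<open>K\<close> with the topology induced by \<open>T\<close>.\<close>

locale compact_action =
  fixes Y :: "'x topology" and act :: "'s::semitopological_semigroup \<Rightarrow> 'x \<Rightarrow> 'x"
  assumes compact: "compact_space Y" and Hausdorff: "Hausdorff_space Y"
    and action: "semigroup_action_on (topspace Y) act"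
    and continuous: "continuous_map (prod_topology euclidean Y) Y (\<lambda>(s, x). act s x)"
begin

lemma act_in [simp]: "x \<in> topspace Y \<Longrightarrow> act s x \<in> topspace Y"
  and act_mult: "x \<in> topspace Y \<Longrightarrow> act (s * t) x = act s (act t x)"
  using action by (auto simp: semigroup_action_on_def)

lemma continuous_map_act: "continuous_map Y Y (act s)"
proof -
  have "continuous_map Y (prod_topology euclidean Y) (\<lambda>x. (s, x))"
    by (simp add: continuous_map_pairedI)
  from continuous_map_compose[OF this continuous] show ?thesis
    by (simp add: o_def)
qed

lemma continuous_map_orbit:
  assumes "x \<in> topspace Y"
  shows "continuous_map euclidean Y (\<lambda>s. act s x)"
proof -
  have "continuous_map euclidean (prod_topology euclidean Y) (\<lambda>s. (s, x))"
    using assms by (simp add: continuous_map_pairedI)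
  from continuous_map_compose[OF this continuous] show ?thesis
    by (simp add: o_def)
qed

section \<open>Minimal closed invariant sets\<close>

definition invariant :: "'x set \<Rightarrow> bool" where
  "invariant A \<longleftrightarrow> closedin Y A \<and> A \<noteq> {} \<and> (\<forall>s. \<forall>x\<in>A. act s x \<in> A)"

definition minimal_invariant :: "'x set \<Rightarrow> bool" where
  "minimal_invariant F \<longleftrightarrow> invariant F \<and> (\<forall>G\<subseteq>F. invariant G \<longrightarrow> G = F)"

lemma invariant_subset: "invariant A \<Longrightarrow> A \<subseteq> topspace Y"
  by (simp add: invariant_def closedin_subset)

lemma ex_minimal_invariant:
  assumes "invariant A"
  obtains F where "F \<subseteq> A" "minimal_invariant F"
proof (rule compact_space_minimal_closed[where P = invariant and A = A and Y = Y])
  show "invariant (\<Inter>\<C>)" if "\<C> \<noteq> {}" "\<And>B. B \<in> \<C> \<Longrightarrow> invariant B" "\<Inter>\<C> \<noteq> {}" for \<C>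
    using that by (auto simp: invariant_def intro!: closedin_Inter)
qed (use assms compact that in \<open>auto simp: invariant_def minimal_invariant_def\<close>)

lemma invariant_orbit_closure:
  assumes "x \<in> topspace Y" "left_ideal J"
  shows "invariant (Y closure_of ((\<lambda>s. act s x) ` J))" (is "invariant (_ closure_of ?O)")
proof -
  have "act s y \<in> Y closure_of ?O" if "y \<in> Y closure_of ?O" for s y
  proof -
    have "act s y \<in> Y closure_of (act s ` ?O)"
      using continuous_map_image_closure_subset[OF continuous_map_act, of s ?O] that by auto
    moreover have "act s ` ?O \<subseteq> ?O"
      using assms by (auto simp: left_ideal_def simp flip: act_mult)
    ultimately show ?thesis
      using closure_of_mono by blast
  qed
  moreover have "?O \<noteq> {}" "?O \<subseteq> topspace Y"
    using assms by (auto simp: left_ideal_def)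
  then have "Y closure_of ?O \<noteq> {}"
    using closure_of_subset by fastforce
  ultimately show ?thesis
    by (auto simp: invariant_def)
qed

text \<open>The closure of the orbit of \<open>x\<close> along \<open>J\<close> is an invariant
  subset of \<open>F\<close>, hence all of \<open>F\<close> by minimality: orbits stay dense in
  \<open>F\<close> even along a small left ideal.\<close>

lemma minimal_invariant_orbit_dense:
  assumes "minimal_invariant F" "x \<in> F" "left_ideal J" "openin Y U" "U \<inter> F \<noteq> {}"
  obtains s where "s \<in> J" "act s x \<in> U"
proof -
  have F: "invariant F" "F \<subseteq> topspace Y" "closedin Y F"
    using assms(1) invariant_subset by (auto simp: minimal_invariant_def invariant_def)
  have "Y closure_of ((\<lambda>s. act s x) ` J) \<subseteq> F"
    using assms(2) F by (intro closure_of_minimal) (auto simp: invariant_def)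
  moreover have "invariant (Y closure_of ((\<lambda>s. act s x) ` J))"
    using assms(2,3) F by (intro invariant_orbit_closure) auto
  ultimately have "Y closure_of ((\<lambda>s. act s x) ` J) = F"
    using assms(1) by (auto simp: minimal_invariant_def)
  with assms(4,5) show thesis
    using that by (force simp: in_closure_of)
qed

text \<open>Every orbit in \<open>F\<close> meets \<open>U\<close>, so the open preimages of
  \<open>U\<close> under the single maps cover \<open>F\<close>; compactness leaves finitely
  many.\<close>

lemma minimal_invariant_finite_cover:
  assumes "minimal_invariant F" "openin Y U" "U \<inter> F \<noteq> {}"
  obtains A where "finite A" "\<And>x. x \<in> F \<Longrightarrow> \<exists>t\<in>A. act t x \<in> U"
proof -
  define V where "V t = {x \<in> topspace Y. act t x \<in> U}" for t
  have F: "F \<subseteq> topspace Y" "closedin Y F"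
    using assms(1) invariant_subset by (auto simp: minimal_invariant_def invariant_def)
  have "compactin Y F"
    by (simp add: F closedin_compact_space compact)
  moreover have "\<And>W. W \<in> range V \<Longrightarrow> openin Y W"
    using openin_continuous_map_preimage[OF continuous_map_act \<open>openin Y U\<close>] by (auto simp: V_def)
  moreover have "F \<subseteq> \<Union>(range V)"
  proof
    fix x assume "x \<in> F"
    moreover have "left_ideal (UNIV :: 's set)"
      by (simp add: left_ideal_def)
    ultimately obtain t where "act t x \<in> U"
      using minimal_invariant_orbit_dense assms by metis
    with \<open>x \<in> F\<close> F show "x \<in> \<Union>(range V)"
      by (auto simp: V_def)
  qed
  ultimately obtain \<F> where \<F>: "finite \<F>" "\<F> \<subseteq> range V" "F \<subseteq> \<Union>\<F>"
    unfolding compactin_def by meson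
  from finite_subset_image[OF \<F>(1,2)] obtain A where A: "finite A" "\<F> = V ` A"
    by blast
  have "\<exists>t\<in>A. act t x \<in> U" if "x \<in> F" for x
    using \<F>(3) A(2) that by (auto simp: V_def)
  with A(1) show thesis
    using that by blast
qed

section \<open>Orbit functions, invariant means and surjectivity on minimal sets\<close>

text \<open>The translate of the orbit function by \<open>s\<close> has the value
  \<open>f (act s y)\<close> at \<open>t\<close>, where \<open>y = act t x\<close>. Joint continuity
  and compactness make this continuous in \<open>s\<close> uniformly in \<open>y\<close>, which is
  norm continuity. Thus a mean can be applied to orbit functions.\<close>

lemma orbit_function_in_LUC:
  assumes f: "continuous_map Y euclideanreal f" and x: "x \<in> topspace Y"
  shows "\<exists>h\<in>LUC. \<forall>t. apply_bcontfun h t = f (act t x)"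
proof -
  have "compactin euclideanreal (f ` topspace Y)"
    using compact f by (metis compact_space_def image_compactin)
  then have bdd: "bounded (f ` topspace Y)"
    by (simp add: compact_imp_bounded)
  have cont: "continuous_on UNIV (\<lambda>t. f (act t x))"
    using continuous_map_compose[OF continuous_map_orbit[OF x] f] by (simp add: o_def)
  have "bounded (range (\<lambda>t. f (act t x)))"
    by (rule bounded_subset[OF bdd]) (use x in auto)
  with cont have "(\<lambda>t. f (act t x)) \<in> bcontfun"
    by (simp add: bcontfun_def)
  then obtain h where h: "apply_bcontfun h = (\<lambda>t. f (act t x))"
    by (metis Bcontfun_inverse)
  have "h \<in> LUC"
    unfolding LUC_def mem_Collect_eq continuous_on_eq_continuous_at[OF open_UNIV]
  proof (intro ballI)
    fix s0 :: 's
    show "isCont (\<lambda>s. left_translate s h) s0"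
      unfolding continuous_at tendsto_iff
    proof (intro allI impI)
      fix e :: real assume "e > 0"
      \<comment> \<open>On \<open>W\<close>, replacing \<open>s0\<close> by \<open>s\<close> changes
        the value by less than \<open>e/2\<close>. The slice over \<open>s0\<close> lies in
        \<open>W\<close>, so the tube lemma gives one neighbourhood of \<open>s0\<close> that works
        for all \<open>y\<close>; the half leaves room for a strict bound on the supremum.\<close>
      define W where "W = {p \<in> topspace (prod_topology euclidean Y).
        (case p of (s, y) \<Rightarrow> f (act s y) - f (act s0 y)) \<in> {-(e/2)<..<e/2}}"
      have 1: "continuous_map (prod_topology euclidean Y) euclideanreal (\<lambda>(s, y). f (act s y))"
        using continuous_map_compose[OF continuous f] by (simp add: o_def case_prod_unfold)
      have 2: "continuous_map (prod_topology (euclidean :: 's topology) Y) euclideanreal (\<lambda>(s, y). f (act s0 y))"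
        using continuous_map_compose[OF continuous_map_compose[OF continuous_map_snd continuous_map_act] f]
        by (simp add: o_def case_prod_unfold)
      have "openin (prod_topology euclidean Y) W"
        unfolding W_def
        by (rule openin_continuous_map_preimage[where Y = euclideanreal])
          (use continuous_map_diff[OF 1 2] in \<open>simp_all add: case_prod_unfold\<close>)
      moreover have "{s0} \<times> topspace Y \<subseteq> W"
        using \<open>e > 0\<close> by (auto simp: W_def)
      ultimately obtain U V where UV: "openin euclidean U" "openin Y V" "s0 \<in> U" "topspace Y \<subseteq> V" "U \<times> V \<subseteq> W"
        using tube_lemma_right[of euclidean Y W "topspace Y" s0] compact by (auto simp: compact_space_def)
      have "dist (left_translate s h) (left_translate s0 h) < e" if "s \<in> U" for s
      proof -
        have "dist (left_translate s h) (left_translate s0 h) \<le> e/2"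
        proof (rule dist_bound)
          fix t
          have "(s, act t x) \<in> W"
            using subsetD[OF UV(5), of "(s, act t x)"] subsetD[OF UV(4)] that x by simp
          then show "dist (apply_bcontfun (left_translate s h) t) (apply_bcontfun (left_translate s0 h) t) \<le> e/2"
            using x by (auto simp: W_def apply_left_translate h act_mult dist_real_def abs_if)
        qed
        with \<open>e > 0\<close> show ?thesis by simp
      qed
      moreover have "eventually (\<lambda>s. s \<in> U) (at s0)"
        using UV(1,3) by (simp add: eventually_at_topological) blast
      ultimately show "\<forall>\<^sub>F s in at s0. dist (left_translate s h) (left_translate s0 h) < e"
        by (rule eventually_mono[rotated])
    qed
  qed
  with h show ?thesis
    by (intro bexI[of _ h]) simp_all
qed

text \<open>If \<open>act s\<close> missed a point \<open>p\<close> of \<open>F\<close>, take a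
  Urysohn function \<open>f\<close>, zero on the image of \<open>F\<close> and one at
  \<open>p\<close>. Its orbit function has mean 0, since its translate by \<open>s\<close> vanishes;
  yet finitely many translates add up to at least 1/2 everywhere.\<close>

lemma minimal_invariant_act_image:
  assumes m: "left_invariant_mean (m :: ('s \<Rightarrow>\<^sub>C real) \<Rightarrow> real)" and F: "minimal_invariant F"
  shows "act s ` F = F"
proof (rule ccontr)
  assume "act s ` F \<noteq> F"
  have F': "invariant F" "F \<subseteq> topspace Y" "closedin Y F" "F \<noteq> {}"
    using assms(2) invariant_subset by (auto simp: minimal_invariant_def invariant_def)
  have "act s ` F \<subseteq> F"
    using F'(1) by (auto simp: invariant_def)
  with \<open>act s ` F \<noteq> F\<close> obtain p where p: "p \<in> F" "p \<notin> act s ` F"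
    by auto
  have "compactin Y (act s ` F)"
    using F' compact by (meson closedin_compact_space continuous_map_act image_compactin)
  then have "closedin Y (act s ` F)"
    using Hausdorff by (simp add: compactin_imp_closedin)
  moreover have "closedin Y {p}"
    using p(1) F' Hausdorff by (auto simp: closedin_Hausdorff_singleton)
  moreover have "normal_space Y"
    by (simp add: Hausdorff compact compact_Hausdorff_or_regular_imp_normal_space)
  ultimately obtain f where f: "continuous_map Y euclideanreal f" "f ` act s ` F \<subseteq> {0}" "f ` {p} \<subseteq> {1}" "f ` topspace Y \<subseteq> {0..1}"
    using Urysohn_lemma[of Y "act s ` F" "{p}" 0 1] p(2)
    by (metis continuous_map_in_subtopology disjnt_insert2 disjnt_empty2 image_subset_iff_funcset zero_le_one)
  define U where "U = {x \<in> topspace Y. f x \<in> {1/2<..}}"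
  have "openin Y U"
    unfolding U_def by (rule openin_continuous_map_preimage[OF f(1)]) simp
  moreover have "p \<in> U \<inter> F"
    using p(1) F' f(3) by (auto simp: U_def)
  ultimately obtain A where A: "finite A" "\<And>x. x \<in> F \<Longrightarrow> \<exists>t\<in>A. act t x \<in> U"
    using minimal_invariant_finite_cover[OF F] by (metis empty_iff)
  obtain y where y: "y \<in> F" "y \<in> topspace Y"
    using F' by auto
  define g where "g B x = (\<Sum>t\<in>B. f (act t x))" for B x
  have g: "continuous_map Y euclideanreal (g B)" if "finite B" for B
    unfolding g_def using that continuous_map_compose[OF continuous_map_act f(1)]
    by (intro continuous_map_sum) (auto simp: o_def)
  have orbit: "\<exists>h\<in>LUC. \<forall>t. apply_bcontfun h t = k (act t y)" if "continuous_map Y euclideanreal k" for k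
    by (rule orbit_function_in_LUC[OF that y(2)])
  obtain h where h: "h \<in> LUC" "\<And>t. apply_bcontfun h t = f (act t y)"
    using orbit[OF f(1)] by auto
  have "left_translate s h = const_bcontfun 0"
    using f(2) y(1) F'(1) by (intro bcontfun_eqI) 
      (auto simp: apply_left_translate h(2) act_mult y(2) const_bcontfun.rep_eq image_subset_iff invariant_def)
  then have "m h = 0"
    using m h(1) mean_const[OF m, of 0] by (metis left_invariant_mean_def)
  \<comment> \<open>Each summand is the orbit function of a left translate of \<open>h\<close>, so
    invariance gives it mean 0. The function \<open>k\<close> varies in the induction, since it
    splits into one translate and the orbit function of the smaller sum.\<close>
  have zero: "m k = 0" if "finite B" "k \<in> LUC" "\<And>t. apply_bcontfun k t = g B (act t y)" for B k
    using that
  proof (induction B arbitrary: k)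
    case empty
    then have "k = const_bcontfun 0"
      by (intro bcontfun_eqI) (simp add: g_def const_bcontfun.rep_eq)
    then show ?case
      using mean_const[OF m, of 0] by simp
  next
    case (insert t B)
    obtain k1 where k1: "k1 \<in> LUC" "\<And>t. apply_bcontfun k1 t = g B (act t y)"
      using orbit[OF g[OF insert.hyps(1)]] by auto
    obtain k2 where k2: "k2 \<in> LUC" "\<And>u. apply_bcontfun k2 u = f (act t (act u y))"
      using orbit[OF continuous_map_compose[OF continuous_map_act f(1)]] by auto
    have "left_translate t h = k2"
      by (intro bcontfun_eqI) (simp add: apply_left_translate h(2) k2(2) act_mult y(2))
    then have "m k2 = 0"
      using m h(1) \<open>m h = 0\<close> by (metis left_invariant_mean_def)
    moreover have "k = k2 + k1"
      by (intro bcontfun_eqI) (simp add: insert.prems(2) k1(2) k2(2) g_def insert.hyps)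
    ultimately show ?case
      using mean_add[OF m k2(1) k1(1)] insert.IH[OF k1] by simp
  qed
  obtain k where k: "k \<in> LUC" "\<And>t. apply_bcontfun k t = g A (act t y)"
    using orbit[OF g[OF A(1)]] by auto
  \<comment> \<open>At each point \<open>act u y\<close> of \<open>F\<close> some \<open>t\<close>
    in \<open>A\<close> leads into \<open>U\<close>, where \<open>f\<close> exceeds 1/2; the other
    summands are nonnegative.\<close>
  have "1/2 \<le> m k"
  proof (rule mean_ge[OF m k(1)])
    fix u
    have "act u y \<in> F"
      using F'(1) y by (auto simp: invariant_def)
    then obtain t where t: "t \<in> A" "act t (act u y) \<in> U"
      using A(2) by blast
    then have "1/2 \<le> f (act t (act u y))"
      by (simp add: U_def)
    also have "\<dots> \<le> g A (act u y)"
      unfolding g_def using t(1) A(1) f(4) y(2) by (intro member_le_sum) (auto simp: image_subset_iff)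
    finally show "1/2 \<le> apply_bcontfun k u"
      by (simp add: k(2))
  qed
  with zero[OF A(1) k] show False
    by simp
qed

section \<open>Limit sets along left ideals\<close>

definition limit_set :: "'x \<Rightarrow> 'x set" where
  "limit_set x = (\<Inter>J\<in>Collect left_ideal. Y closure_of ((\<lambda>s. act s x) ` J))"

text \<open>Being an intersection over all left ideals, the limit set inherits what holds along a
  single one. This is how contraction estimates, given on a left ideal that depends on the point,
  are used.\<close>

lemma limit_set_subset:
  "left_ideal J \<Longrightarrow> closedin Y C \<Longrightarrow> (\<And>s. s \<in> J \<Longrightarrow> act s x \<in> C) \<Longrightarrow> limit_set x \<subseteq> C"
  unfolding limit_set_def using closure_of_minimal[of "(\<lambda>s. act s x) ` J" C Y] by blast

text \<open>Right reversibility gives finitely many left ideals a common point \<open>s\<close> of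
  their closures; continuity of the orbit map then puts \<open>act s x\<close> into each orbit
  closure. Compactness does the rest, and invariance is inherited from the orbit closures.\<close>

lemma invariant_limit_set:
  assumes "right_reversible TYPE('s)" "x \<in> topspace Y"
  shows "invariant (limit_set x)"
proof -
  define C where "C J = Y closure_of ((\<lambda>s. act s x) ` J)" for J
  have C: "closedin Y (C J)" for J
    by (simp add: C_def)
  have "\<Inter>\<F> \<noteq> {}" if \<F>: "finite \<F>" "\<F> \<subseteq> C ` Collect left_ideal" for \<F>
  proof -
    obtain \<J> where \<J>: "finite \<J>" "\<J> \<subseteq> Collect left_ideal" "\<F> = C ` \<J>"
      using finite_subset_image[OF \<F>] by auto
    have "\<Inter>(closure ` \<J>) \<noteq> {}"
      using \<J> assms(1) by (intro right_reversible_finite_Inter) (auto intro: left_ideal_closure)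
    then obtain s where s: "\<And>J. J \<in> \<J> \<Longrightarrow> s \<in> closure J"
      by auto
    have "act s x \<in> C J" if "J \<in> \<J>" for J
      using continuous_map_image_closure_subset[OF continuous_map_orbit[OF assms(2)], of J] s[OF that]
      by (auto simp: C_def euclidean_closure_of)
    with \<J>(3) show ?thesis
      by blast
  qed
  then have "\<Inter>(C ` Collect left_ideal) \<noteq> {}"
    using compact C by (auto simp: compact_space_fip)
  moreover have "left_ideal (UNIV :: 's set)"
    by (simp add: left_ideal_def)
  then have "closedin Y (\<Inter>(C ` Collect left_ideal))"
    using C by (intro closedin_Inter) auto
  ultimately show ?thesis
    using invariant_orbit_closure[OF assms(2)]
    by (auto simp: invariant_def limit_set_def C_def)
qed

end

section \<open>Pseudometrics that are eventually contracted\<close>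

context compact_action
begin

text \<open>
  A set of small diameter with nonempty interior in \<open>F\<close>, which exists by Baire's theorem, has
  finitely many preimages covering \<open>F\<close>. Right reversibility makes all of these preimages be
  contracted, in the limit, by a single \<open>s\<close>, and \<open>F\<close> is its own image under \<open>s\<close>.
\<close>

lemma minimal_invariant_finite_net:
  fixes D :: "'x \<Rightarrow> 'x \<Rightarrow> real"
  assumes rev: "right_reversible TYPE('s)"
    and F: "minimal_invariant F" and surj: "\<And>s. act s ` F = F"
    and sym: "\<And>x y. D x y = D y x" and tri: "\<And>x y z. D x z \<le> D x y + D y z"
    and lsc: "\<And>r. openin (prod_topology Y Y) {(x, y). x \<in> topspace Y \<and> y \<in> topspace Y \<and> r < D x y}"
    and nonexp: "\<And>x. x \<in> topspace Y \<Longrightarrow>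
      \<exists>J. left_ideal J \<and> (\<forall>s\<in>J. \<forall>y\<in>topspace Y. D (act s x) (act s y) \<le> D x y)"
    and C: "countable C" "C \<subseteq> topspace Y" "\<And>x. x \<in> F \<Longrightarrow> \<exists>c\<in>C. D c x \<le> e / 2"
  obtains N where "finite N" "N \<subseteq> F" "\<And>x. x \<in> F \<Longrightarrow> \<exists>w\<in>N. D w x \<le> e"
proof -
  have F': "invariant F" "F \<subseteq> topspace Y" "closedin Y F" "F \<noteq> {}"
    using F invariant_subset by (auto simp: minimal_invariant_def invariant_def)
  \<comment> \<open>By lower semicontinuity these pieces are closed, and countably many of them
    cover \<open>F\<close>. The centres may lie outside \<open>F\<close>.\<close>
  define B where "B c = F \<inter> {x \<in> topspace Y. D c x \<le> e / 2}" for c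
  let ?YF = "subtopology Y F"
  have ball: "closedin Y {x \<in> topspace Y. D c x \<le> e / 2}" if "c \<in> topspace Y" for c
  proof -
    have "continuous_map Y (prod_topology Y Y) (\<lambda>x. (c, x))"
      using that by (simp add: continuous_map_pairedI)
    from openin_continuous_map_preimage[OF this lsc[of "e / 2"]]
    have "openin Y {x \<in> topspace Y. e / 2 < D c x}"
      using that by (simp add: conj_commute cong: conj_cong)
    moreover have "topspace Y - {x \<in> topspace Y. D c x \<le> e / 2} = {x \<in> topspace Y. e / 2 < D c x}"
      by auto
    ultimately show ?thesis
      by (auto simp: closedin_def)
  qed
  \<comment> \<open>\<open>F\<close> is compact Hausdorff, so by Baire's theorem one piece of the
    countable closed cover has interior in \<open>F\<close>.\<close>
  have "\<exists>c\<in>C. ?YF interior_of B c \<noteq> {}"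
  proof (rule ccontr)
    assume *: "\<not> (\<exists>c\<in>C. ?YF interior_of B c \<noteq> {})"
    have "compact_space ?YF" "Hausdorff_space ?YF"
      using F'(3) compact Hausdorff
      by (simp_all add: closedin_compact_space compact_space_subtopology Hausdorff_space_subtopology)
    then have "locally_compact_space ?YF" "regular_space ?YF"
      by (simp_all add: compact_imp_locally_compact_space compact_Hausdorff_imp_regular_space)
    then have "?YF interior_of \<Union>(B ` C) = {}"
    proof (intro Baire_category_alt)
      show "closedin ?YF T \<and> ?YF interior_of T = {}" if "T \<in> B ` C" for T
        using that * ball C(2) F'(3) by (auto simp: B_def closedin_subtopology_Int_closed)
    qed (use C(1) in auto)
    moreover have "\<Union>(B ` C) = topspace ?YF"
      using C(3) F'(2) by (auto simp: B_def)
    ultimately show False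
      using F'(2,4) by (metis interior_of_topspace topspace_subtopology_subset)
  qed
  then obtain c y0 where c: "c \<in> C" "y0 \<in> ?YF interior_of B c"
    by auto
  then obtain U where U: "openin Y U" "U \<inter> F \<subseteq> B c" "y0 \<in> U \<inter> F"
    by (auto simp: interior_of_def openin_subtopology)
  \<comment> \<open>The centre moves from \<open>c\<close> to the point \<open>y0\<close> of
    \<open>F\<close>; the two halves \<open>e / 2\<close> add up to \<open>e\<close>.\<close>
  have small: "D y0 z \<le> e" if "z \<in> U" "z \<in> F" for z
  proof -
    have "D c y0 \<le> e / 2" "D c z \<le> e / 2"
      using U that by (auto simp: B_def)
    then show ?thesis
      using tri[of y0 z c] sym[of y0 c] by linarith
  qed
  have y0: "y0 \<in> F" "y0 \<in> topspace Y"
    using U(3) F'(2) by auto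
  obtain J where J: "left_ideal J" "\<And>s y. s \<in> J \<Longrightarrow> y \<in> topspace Y \<Longrightarrow> D (act s y0) (act s y) \<le> D y0 y"
    using nonexp[OF y0(2)] by auto
  obtain A where A: "finite A" "\<And>x. x \<in> F \<Longrightarrow> \<exists>t\<in>A. act t x \<in> U"
    using minimal_invariant_finite_cover[OF F U(1)] U(3) by blast
  \<comment> \<open>Right translates of \<open>J\<close> are left ideals. A common point
    \<open>s\<close> of their closures is approximated by products \<open>j * t\<close> with
    \<open>j\<close> in \<open>J\<close>, for every \<open>t\<close> in the finite set
    \<open>A\<close>.\<close>
  have "\<Inter>((\<lambda>t. closure ((\<lambda>j. j * t) ` J)) ` A) \<noteq> {}"
    using A(1) J(1)
    by (intro right_reversible_finite_Inter[OF rev]) (auto intro!: left_ideal_closure left_ideal_image_mult)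
  then obtain s where s: "\<And>t. t \<in> A \<Longrightarrow> s \<in> closure ((\<lambda>j. j * t) ` J)"
    by auto
  have "\<exists>w\<in>F. \<forall>z\<in>F. act t z \<in> U \<longrightarrow> D w (act s z) \<le> e" if "t \<in> A" for t
  proof -
    \<comment> \<open>A common member \<open>w\<close> of all \<open>L V\<close> is a cluster point
      of \<open>act j y0\<close> as \<open>j * t\<close> tends to \<open>s\<close>; it exists by
      compactness and becomes the net point belonging to \<open>t\<close>.\<close>
    define L where "L V = Y closure_of ((\<lambda>j. act j y0) ` {j \<in> J. j * t \<in> V})" for V
    have sub: "(\<lambda>j. act j y0) ` {j \<in> J. j * t \<in> V} \<subseteq> L V" for V
      unfolding L_def by (rule closure_of_subset) (use y0 in auto)
    have "\<Inter>\<F> \<noteq> {}" if \<F>: "finite \<F>" "\<F> \<subseteq> L ` {V. open V \<and> s \<in> V}" for \<F>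
    proof -
      obtain \<V> where \<V>: "finite \<V>" "\<V> \<subseteq> {V. open V \<and> s \<in> V}" "\<F> = L ` \<V>"
        using finite_subset_image[OF \<F>] by auto
      then have "open (\<Inter>\<V>)" "s \<in> \<Inter>\<V>"
        by (auto intro: open_Inter)
      then have "\<Inter>\<V> \<inter> (\<lambda>j. j * t) ` J \<noteq> {}"
        using s[OF \<open>t \<in> A\<close>] open_Int_closure_eq_empty[of "\<Inter>\<V>"] by blast
      then obtain j where "j \<in> J" "j * t \<in> \<Inter>\<V>"
        by blast
      then have "act j y0 \<in> L V" if "V \<in> \<V>" for V
        using that by (intro subsetD[OF sub]) auto
      with \<V>(3) show ?thesis
        by blast
    qed
    then have "\<Inter>(L ` {V. open V \<and> s \<in> V}) \<noteq> {}"
      using compact by (auto simp: compact_space_fip L_def)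
    then obtain w where w: "\<And>V. open V \<Longrightarrow> s \<in> V \<Longrightarrow> w \<in> L V"
      by auto
    have "L UNIV \<subseteq> F"
      unfolding L_def using F' y0 by (intro closure_of_minimal) (auto simp: invariant_def)
    then have "w \<in> F"
      using w[of UNIV] by auto
    \<comment> \<open>Otherwise lower semicontinuity keeps the distance above \<open>e\<close> near
      \<open>(w, act s z)\<close>, and some \<open>j\<close> in \<open>J\<close> carries
      \<open>(y0, act t z)\<close> into that neighbourhood. But \<open>act t z\<close> lies in
      \<open>U\<close>, within \<open>e\<close> of \<open>y0\<close>, and \<open>j\<close> does not
      expand this distance.\<close>
    moreover have "D w (act s z) \<le> e" if z: "z \<in> F" "act t z \<in> U" for z
    proof (rule ccontr)
      assume *: "\<not> D w (act s z) \<le> e"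
      have zY: "z \<in> topspace Y"
        using z F'(2) by auto
      have "(w, act s z) \<in> {(x, y). x \<in> topspace Y \<and> y \<in> topspace Y \<and> e < D x y}"
        using * \<open>w \<in> F\<close> zY F'(2) by auto
      from lsc[of e, unfolded openin_prod_topology_alt, rule_format, OF this]
      obtain O1 O2 where O: "openin Y O1" "openin Y O2" "w \<in> O1" "act s z \<in> O2"
        and "O1 \<times> O2 \<subseteq> {(x, y). x \<in> topspace Y \<and> y \<in> topspace Y \<and> e < D x y}"
        by (elim exE conjE)
      then have far: "e < D a b" if "a \<in> O1" "b \<in> O2" for a b
        using that by blast
      define V where "V = {v. act v z \<in> O2}"
      have "open V"
        using openin_continuous_map_preimage[OF continuous_map_orbit[OF zY] O(2)] by (simp add: V_def)
      then have "w \<in> L V"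
        using w O(4) by (simp add: V_def)
      then obtain j where j: "j \<in> J" "j * t \<in> V" "act j y0 \<in> O1"
        using O(1,3) by (auto simp: L_def in_closure_of)
      have "act t z \<in> F"
        using F'(1) z(1) by (auto simp: invariant_def)
      then have "D (act j y0) (act j (act t z)) \<le> e"
        using J(2)[OF j(1), of "act t z"] small[OF z(2)] F'(2) by fastforce
      moreover have "e < D (act j y0) (act j (act t z))"
        using far[OF j(3)] j(2) zY by (simp add: V_def act_mult)
      ultimately show False
        by simp
    qed
    ultimately show ?thesis
      by blast
  qed
  then obtain w where w: "\<And>t. t \<in> A \<Longrightarrow> w t \<in> F"
    "\<And>t z. t \<in> A \<Longrightarrow> z \<in> F \<Longrightarrow> act t z \<in> U \<Longrightarrow> D (w t) (act s z) \<le> e"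
    by metis
  \<comment> \<open>Since \<open>act s\<close> maps \<open>F\<close> onto itself, every point of
    \<open>F\<close> is some \<open>act s z\<close>, so the finitely many \<open>w t\<close> form an
    \<open>e\<close>-net.\<close>
  have "\<exists>v\<in>w ` A. D v x \<le> e" if "x \<in> F" for x
  proof -
    obtain z where "z \<in> F" "x = act s z"
      using surj[of s] \<open>x \<in> F\<close> by blast
    with A(2)[of z] w(2)[of _ z] show ?thesis
      by blast
  qed
  with A(1) w(1) show thesis
    by (intro that[of "w ` A"]) auto
qed

end

section \<open>Seminorms\<close>

lemma seminorm_triangle: "seminorm p \<Longrightarrow> p (x + y) \<le> p x + p y"
  and seminorm_scaleR: "seminorm p \<Longrightarrow> p (c *\<^sub>R x) = \<bar>c\<bar> * p x"
  by (simp_all add: seminorm_def)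

lemma seminorm_zero: "seminorm p \<Longrightarrow> p 0 = 0"
  using seminorm_scaleR[of p 0 0] by simp

lemma seminorm_diff_commute: "seminorm p \<Longrightarrow> p (x - y) = p (y - x)"
  using seminorm_scaleR[of p "-1" "x - y"] by simp

lemma seminorm_diff_triangle: "seminorm p \<Longrightarrow> p (x - z) \<le> p (x - y) + p (y - z)"
  using seminorm_triangle[of p "x - y" "y - z"] by simp

lemma seminorm_nonneg: "seminorm p \<Longrightarrow> 0 \<le> p x"
  using seminorm_diff_triangle[of p x x 0] seminorm_diff_commute[of p 0 x]
  by (simp add: seminorm_zero)

lemma seminorm_sum_le: "seminorm p \<Longrightarrow> p (sum f A) \<le> (\<Sum>a\<in>A. p (f a))"
proof (induction A rule: infinite_finite_induct)
  case (insert a A)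
  then show ?case
    using seminorm_triangle[of p "f a" "sum f A"] by simp
qed (simp_all add: seminorm_zero)

lemma convex_seminorm_cball:
  assumes "seminorm p"
  shows "convex {x. p (x - y) \<le> r}"
proof (rule convexI)
  fix a b :: 'a and u v :: real
  assume *: "a \<in> {x. p (x - y) \<le> r}" "b \<in> {x. p (x - y) \<le> r}" "0 \<le> u" "0 \<le> v" "u + v = 1"
  have "y = (u + v) *\<^sub>R y"
    using * by simp
  then have "u *\<^sub>R a + v *\<^sub>R b - y = u *\<^sub>R (a - y) + v *\<^sub>R (b - y)"
    by (simp add: algebra_simps)
  then have "p (u *\<^sub>R a + v *\<^sub>R b - y) \<le> u * p (a - y) + v * p (b - y)"
    using seminorm_triangle[OF assms, of "u *\<^sub>R (a - y)" "v *\<^sub>R (b - y)"] *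
    by (simp add: seminorm_scaleR[OF assms])
  also have "\<dots> \<le> r"
    using * by (intro convex_bound_le) auto
  finally show "u *\<^sub>R a + v *\<^sub>R b \<in> {x. p (x - y) \<le> r}"
    by simp
qed

text \<open>Normal structure: the centroid of a finite net is a non-diametral point.\<close>

lemma finite_net_nondiametral_point:
  assumes p: "seminorm p" and N: "finite N" "N \<noteq> {}" "N \<subseteq> F"
    and d: "0 < d" "\<And>x y. x \<in> F \<Longrightarrow> y \<in> F \<Longrightarrow> p (x - y) \<le> d"
    and net: "\<And>x. x \<in> F \<Longrightarrow> \<exists>w\<in>N. p (w - x) \<le> d / 2"
  obtains u r where "u \<in> convex hull F" "r < d" "\<And>x. x \<in> F \<Longrightarrow> p (u - x) \<le> r"
proof
  let ?m = "real (card N)"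
  let ?u = "\<Sum>w\<in>N. (1 / ?m) *\<^sub>R w"
  have m: "0 < ?m"
    using N by (simp add: card_gt_0_iff)
  have "?u \<in> convex hull N"
    using N m by (intro convex_sum) (auto intro: hull_inc)
  then show "?u \<in> convex hull F"
    using hull_mono[OF N(3)] by blast
  \<comment> \<open>Of the \<open>?m\<close> distances averaged by the centroid, the one from the
    near net point is at most \<open>d / 2\<close> and the others are at most \<open>d\<close>,
    which gives this radius.\<close>
  show "d - d / 2 / ?m < d"
    using m d(1) by simp
  show "p (?u - x) \<le> d - d / 2 / ?m" if x: "x \<in> F" for x
  proof -
    obtain w where w: "w \<in> N" "p (w - x) \<le> d / 2"
      using net[OF x] by auto
    have "(\<Sum>v\<in>N. (1 / ?m) *\<^sub>R x) = x"
      using m by (simp add: sum_constant_scaleR)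
    then have "?u - x = (\<Sum>v\<in>N. (1 / ?m) *\<^sub>R (v - x))"
      by (simp add: scaleR_diff_right sum_subtractf)
    then have "p (?u - x) \<le> (\<Sum>v\<in>N. p ((1 / ?m) *\<^sub>R (v - x)))"
      using seminorm_sum_le[OF p, of "\<lambda>v. (1 / ?m) *\<^sub>R (v - x)" N] by simp
    also have "\<dots> = (\<Sum>v\<in>N. p (v - x)) / ?m"
      by (simp add: seminorm_scaleR[OF p] sum_divide_distrib)
    also have "(\<Sum>v\<in>N. p (v - x)) = p (w - x) + (\<Sum>v\<in>N - {w}. p (v - x))"
      using w(1) N(1) by (simp add: sum.remove)
    also have "\<dots> \<le> d / 2 + real (card (N - {w})) * d"
      using w d(2) x N(3) by (intro add_mono sum_bounded_above) auto
    also have "real (card (N - {w})) = ?m - 1"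
      using w(1) N(1) m by (simp add: of_nat_diff card_Diff_singleton Suc_leI card_gt_0_iff)
    finally show ?thesis
      using m by (simp add: field_simps divide_right_mono)
  qed
qed

section \<open>The topologies on the vector space\<close>

lemma topspace_seminorm_topology:
  assumes q: "\<And>n. seminorm (q n)"
  shows "topspace (seminorm_topology q) = UNIV"
proof -
  have "z \<in> topspace (seminorm_topology q)" for z
  proof -
    have "z \<in> {y. q 0 (y - z) < 1}"
      by (simp add: seminorm_zero q)
    moreover have "{y. q 0 (y - z) < 1} \<in> {{y. q n (y - x) < r} | n x r. r > (0::real)}"
      unfolding mem_Collect_eq by (intro exI[of _ 0] exI[of _ z] exI[of _ 1]) simp
    ultimately show ?thesis
      unfolding seminorm_topology_def topology_generated_by_topspace by (rule UnionI[rotated])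
  qed
  then show ?thesis
    by auto
qed

text \<open>When all seminorms vanish on \<open>x - y\<close>, a subbasic ball containing
  \<open>x\<close> also contains \<open>y\<close>; by induction so does every open set, against the
  Hausdorff property.\<close>

lemma seminorm_topology_separates:
  assumes q: "\<And>n. seminorm (q n)" and H: "Hausdorff_space (seminorm_topology q)"
    and zero: "\<And>n. q n (x - y) = 0"
  shows "x = y"
proof (rule ccontr)
  assume "x \<noteq> y"
  let ?B = "{{y. q n (y - x) < r} | n x r. r > (0::real)}"
  have move: "y \<in> U" if "generate_topology_on ?B U" "x \<in> U" for U
    using that
  proof induction
    case (Basis S)
    then obtain n a r where S: "S = {y. q n (y - a) < r}"
      by auto
    have "q n (y - a) \<le> q n (y - x) + q n (x - a)"
      using seminorm_diff_triangle[OF q] .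
    with Basis(2) S show ?case
      using zero[of n] seminorm_diff_commute[OF q, of n x y] by simp
  qed auto
  from \<open>x \<noteq> y\<close> obtain U V where "openin (seminorm_topology q) U" "x \<in> U" "y \<in> V" "disjnt U V"
    using H[unfolded Hausdorff_space_def, rule_format, of x y] topspace_seminorm_topology[OF q] by auto
  with move[of U] show False
    by (auto simp: seminorm_topology_def openin_topology_generated_by_iff disjnt_def)
qed

lemma continuous_map_diff_locally_convex:
  assumes "locally_convex_topology T"
  shows "continuous_map (prod_topology T T) T (\<lambda>(x, y). x - y)"
proof -
  have T: "continuous_map (prod_topology T T) T (\<lambda>(x, y). x + y)"
    "continuous_map (prod_topology euclideanreal T) T (\<lambda>(c, x). c *\<^sub>R x)"
    using assms by (auto simp: locally_convex_topology_def)
  have "continuous_map T (prod_topology euclideanreal T) (\<lambda>x. (- 1, x))"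
    by (simp add: continuous_map_pairedI)
  from continuous_map_compose[OF this T(2)] have "continuous_map T T (\<lambda>x. - x)"
    by (simp add: o_def)
  from continuous_map_compose[OF continuous_map_snd this]
  have "continuous_map (prod_topology T T) (prod_topology T T) (\<lambda>z. (fst z, - snd z))"
    by (intro continuous_map_pairedI continuous_map_fst) (simp add: o_def)
  from continuous_map_compose[OF this T(1)] show ?thesis
    by (simp add: o_def case_prod_unfold)
qed

theorem corollary2p13:
  fixes q :: "nat \<Rightarrow> 'x::real_vector \<Rightarrow> real"
    and T :: "'x topology"
    and K :: "'x set"
    and act :: "'s::semitopological_semigroup \<Rightarrow> 'x \<Rightarrow> 'x"
  assumes "right_reversible TYPE('s)"
    and "\<exists>m :: ('s \<Rightarrow>\<^sub>C real) \<Rightarrow> real. left_invariant_mean m"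
    and "frechet_space q"
    and "admissible_topology q T"
    and "K \<noteq> {}"
    and "compactin T K"
    and "convex K"
    and "separable_space (subtopology (seminorm_topology q) K)"
    and "semigroup_action_on K act"
    and "super_asymptotically_uniformly_nonexpansive q K act"
    and "jointly_continuous_action T K act"
  shows "\<exists>x0\<in>K. \<forall>s. act s x0 = x0"
proof -

  \<comment> \<open>Reduction to a compact action with lower semicontinuous seminorm
    distances\<close>
  have q: "seminorm (q n)" for n
    using assms(3) by (simp add: frechet_space_def)
  have sep: "x = y" if "\<And>n. q n (x - y) = 0" for x y
    by (rule seminorm_topology_separates[of q, OF q _ that])
      (use assms(3) in \<open>simp add: frechet_space_def locally_convex_topology_def\<close>)
  have T: "locally_convex_topology T" "topspace T = UNIV" "Hausdorff_space T"
    and lsc: "openin T {x. r < q n x}" for n r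
    using assms(4) by (auto simp: admissible_topology_def locally_convex_topology_def lower_semicontinuous_map_def)
  define Y where "Y = subtopology T K"
  have Y: "topspace Y = K"
    by (simp add: Y_def T(2))
  interpret compact_action Y act
  proof
    show "compact_space Y" "Hausdorff_space Y"
      using assms(6) T by (simp_all add: Y_def compact_space_subtopology Hausdorff_space_subtopology)
  qed (use assms(9,11) in \<open>simp_all add: Y jointly_continuous_action_def flip: Y_def\<close>)
  \<comment> \<open>Subtraction is continuous for \<open>T\<close>, so lower semicontinuity of
    \<open>q n\<close> passes to the distance as a function of two variables.\<close>
  have lscY: "openin (prod_topology Y Y) {(x, y). x \<in> topspace Y \<and> y \<in> topspace Y \<and> r < q n (x - y)}" for n r
  proof -
    have "continuous_map (prod_topology Y Y) T (\<lambda>(x, y). x - y)"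
      unfolding Y_def subtopology_Times[symmetric]
      by (intro continuous_map_from_subtopology continuous_map_diff_locally_convex T)
    from openin_continuous_map_preimage[OF this lsc[of r n]]
    show ?thesis
      by (rule back_subst[of "openin _"]) auto
  qed
  have nonexp: "\<exists>J. left_ideal J \<and> (\<forall>s\<in>J. \<forall>y\<in>K. \<forall>n. q n (act s x - act s y) \<le> q n (x - y))"
    if "x \<in> K" for x
  proof -
    \<comment> \<open>Any \<open>t\<close> will do: the elements \<open>s * t\<close> with
      \<open>s\<close> in \<open>I\<close> again form a left ideal.\<close>
    obtain t :: 's where True by simp
    obtain I where I: "left_ideal I"
      "\<And>s y n. s \<in> I \<Longrightarrow> y \<in> K \<Longrightarrow> q n (act (s * t) x - act (s * t) y) \<le> q n (x - y)"
      using assms(10) \<open>x \<in> K\<close> unfolding super_asymptotically_uniformly_nonexpansive_def by meson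
    then show ?thesis
      by (intro exI[of _ "(\<lambda>s. s * t) ` I"]) (auto intro: left_ideal_image_mult)
  qed
  obtain C where C: "countable C" "C \<subseteq> K" "subtopology (seminorm_topology q) K closure_of C = K"
    using assms(8) by (auto simp: separable_space_def topspace_seminorm_topology[OF q])
  have dense: "\<exists>c\<in>C. q n (c - x) \<le> e" if "x \<in> K" "e > 0" for n x e
  proof -
    let ?B = "{y. q n (y - x) < e}"
    have "openin (seminorm_topology q) ?B"
      using \<open>e > 0\<close> unfolding seminorm_topology_def
      by (intro topology_generated_by_Basis) auto
    then have "openin (subtopology (seminorm_topology q) K) (?B \<inter> K)"
      by (rule openin_subtopology_Int)
    moreover have "x \<in> ?B \<inter> K"
      using that by (simp add: seminorm_zero q)
    moreover have "x \<in> subtopology (seminorm_topology q) K closure_of C"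
      using C(3) \<open>x \<in> K\<close> by simp
    note this[unfolded in_closure_of, THEN conjunct2, rule_format, of "?B \<inter> K"]
    ultimately have "\<exists>c\<in>C. c \<in> ?B \<inter> K"
      by (simp add: Bex_def)
    then show ?thesis
      by (auto intro: less_imp_le)
  qed

  \<comment> \<open>A minimal convex set containing the limit sets of its points\<close>
  define P where "P X \<longleftrightarrow> closedin Y X \<and> X \<noteq> {} \<and> convex X \<and> (\<forall>x\<in>X. limit_set x \<subseteq> X)" for X
  obtain M where M: "P M" and min: "\<And>X. X \<subseteq> M \<Longrightarrow> P X \<Longrightarrow> X = M"
  proof (rule compact_space_minimal_closed[of Y P K])
    have "limit_set x \<subseteq> topspace Y" if "x \<in> topspace Y" for x
      using that by (intro limit_set_subset[of UNIV]) (auto simp: left_ideal_def)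
    then show "P K"
      using assms(5,7) by (simp add: P_def Y flip: Y)
    show "P (\<Inter>\<C>)" if "\<C> \<noteq> {}" "\<And>B. B \<in> \<C> \<Longrightarrow> P B" "\<Inter>\<C> \<noteq> {}" for \<C>
      using that by (auto simp: P_def intro!: closedin_Inter convex_Inter)
  qed (use compact in \<open>auto simp: P_def\<close>)
  then have "M \<subseteq> topspace Y" "M \<noteq> {}" "convex M"
    by (simp_all add: P_def closedin_subset)
  then have "M \<subseteq> K"
    by (simp add: Y)
  then obtain x where x: "x \<in> M" "x \<in> K"
    using \<open>M \<noteq> {}\<close> by auto
  \<comment> \<open>Taking \<open>F\<close> inside the limit set of a point of \<open>M\<close>
    ensures that \<open>F\<close> lies in \<open>M\<close>.\<close>
  obtain F where F: "F \<subseteq> limit_set x" "minimal_invariant F"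
    using ex_minimal_invariant invariant_limit_set[OF assms(1)] x Y by metis
  have "F \<subseteq> M"
    using F(1) M x by (auto simp: P_def)
  have surj: "act s ` F = F" for s
    using minimal_invariant_act_image[OF _ F(2)] assms(2) by auto
  have "F \<noteq> {}"
    using F(2) by (auto simp: minimal_invariant_def invariant_def)
  have net: "\<exists>N. finite N \<and> N \<subseteq> F \<and> (\<forall>x\<in>F. \<exists>w\<in>N. q n (w - x) \<le> e)" if "e > 0" for n e
  proof (rule minimal_invariant_finite_net[OF assms(1) F(2) surj, where D = "\<lambda>x y. q n (x - y)"])
    show "\<exists>J. left_ideal J \<and> (\<forall>s\<in>J. \<forall>y\<in>topspace Y. q n (act s x - act s y) \<le> q n (x - y))"
      if "x \<in> topspace Y" for x
      using nonexp that unfolding Y by blast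
    show "\<exists>c\<in>C. q n (c - x) \<le> e / 2" if "x \<in> F" for x
      using dense[of x "e / 2"] that \<open>e > 0\<close> \<open>F \<subseteq> M\<close> \<open>M \<subseteq> K\<close> by auto
  qed (use C lscY Y seminorm_diff_commute[OF q] seminorm_diff_triangle[OF q] in blast)+

  \<comment> \<open>The minimal invariant set has diameter zero\<close>
  have zero: "q n (x - y) = 0" if xy: "x \<in> F" "y \<in> F" for n x y
  proof (rule ccontr)
    assume "q n (x - y) \<noteq> 0"
    define d where "d = (SUP (x, y)\<in>F \<times> F. q n (x - y))"
    obtain N where N: "finite N" "N \<subseteq> F" "\<And>x. x \<in> F \<Longrightarrow> \<exists>w\<in>N. q n (w - x) \<le> 1"
      using net[of 1 n] by auto
    \<comment> \<open>Two points of \<open>F\<close> are joined by steps of length at most 1 to the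
      net and a distance within the net, which the finite sum dominates.\<close>
    have bdd: "bdd_above ((\<lambda>(x, y). q n (x - y)) ` (F \<times> F))"
    proof (rule bdd_aboveI2)
      fix z assume "z \<in> F \<times> F"
      then obtain a b v w where z: "z = (a, b)" "v \<in> N" "w \<in> N" "q n (v - a) \<le> 1" "q n (w - b) \<le> 1"
        using N(3) by (metis SigmaE)
      have "q n (v - w) \<le> (\<Sum>(v, w)\<in>N \<times> N. q n (v - w))"
        using member_le_sum[of "(v, w)" "N \<times> N" "\<lambda>(v, w). q n (v - w)"] z N(1) seminorm_nonneg[OF q]
        by auto
      then show "(case z of (x, y) \<Rightarrow> q n (x - y)) \<le> 1 + (\<Sum>(v, w)\<in>N \<times> N. q n (v - w)) + 1"
        using z seminorm_diff_triangle[OF q, of n a b v] seminorm_diff_triangle[OF q, of n v b w]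
          seminorm_diff_commute[OF q, of n a v] by simp
    qed
    have d: "q n (a - b) \<le> d" if "a \<in> F" "b \<in> F" for a b
      using cSUP_upper[OF _ bdd, of "(a, b)"] that by (simp add: d_def)
    have "0 < d"
      using d[OF xy] seminorm_nonneg[OF q, of n "x - y"] \<open>q n (x - y) \<noteq> 0\<close> by simp
    obtain N where N: "finite N" "N \<subseteq> F" "\<And>x. x \<in> F \<Longrightarrow> \<exists>w\<in>N. q n (w - x) \<le> d / 2"
      using net[of "d / 2" n] \<open>0 < d\<close> by auto
    then have "N \<noteq> {}"
      using \<open>F \<noteq> {}\<close> by blast
    obtain u r where u: "u \<in> convex hull F" "r < d" "\<And>x. x \<in> F \<Longrightarrow> q n (u - x) \<le> r"
      using finite_net_nondiametral_point[OF q N(1) \<open>N \<noteq> {}\<close> N(2) \<open>0 < d\<close> d N(3)] by metis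
    \<comment> \<open>The points of \<open>M\<close> whose ball of radius \<open>r\<close> covers
      \<open>F\<close>; \<open>u\<close> is one of them. Minimality will make this all of
      \<open>M\<close>, so that \<open>F\<close> has diameter at most \<open>r < d\<close>.\<close>
    define X where "X = M \<inter> (\<Inter>y\<in>F. {x \<in> K. q n (x - y) \<le> r})"
    have ball: "closedin Y {x \<in> K. q n (x - y) \<le> r}" if "y \<in> F" for y
    proof -
      have "continuous_map Y (prod_topology Y Y) (\<lambda>x. (x, y))"
        using that \<open>F \<subseteq> M\<close> \<open>M \<subseteq> K\<close> by (auto simp: continuous_map_pairedI Y)
      from openin_continuous_map_preimage[OF this lscY[of r n]]
      have "openin Y {x \<in> K. r < q n (x - y)}"
        using that \<open>F \<subseteq> M\<close> \<open>M \<subseteq> K\<close> by (auto simp: Y subset_iff conj_commute cong: conj_cong)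
      moreover have "K - {x \<in> K. q n (x - y) \<le> r} = {x \<in> K. r < q n (x - y)}"
        by auto
      ultimately show ?thesis
        by (auto simp: closedin_def Y)
    qed
    have "P X"
      unfolding P_def
    proof (intro conjI ballI)
      show "closedin Y X"
        unfolding X_def using M \<open>F \<noteq> {}\<close> ball by (intro closedin_Int closedin_Inter) (auto simp: P_def)
      have "u \<in> M"
        using u(1) hull_minimal[OF \<open>F \<subseteq> M\<close>, of convex] \<open>convex M\<close> by blast
      with u(3) \<open>M \<subseteq> K\<close> show "X \<noteq> {}"
        by (auto simp: X_def)
      have "X = M \<inter> (\<Inter>y\<in>F. {x. q n (x - y) \<le> r})"
        using \<open>M \<subseteq> K\<close> by (auto simp: X_def)
      then show "convex X"
        using \<open>convex M\<close> by (auto intro!: convex_Int convex_INT convex_seminorm_cball q)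
      fix z assume z: "z \<in> X"
      then have "z \<in> K"
        using \<open>M \<subseteq> K\<close> by (auto simp: X_def)
      then obtain J where J: "left_ideal J" "\<And>s y. s \<in> J \<Longrightarrow> y \<in> K \<Longrightarrow> q n (act s z - act s y) \<le> q n (z - y)"
        using nonexp by blast
      \<comment> \<open>Write \<open>y = act s y'\<close> with \<open>y'\<close> in
        \<open>F\<close>: then \<open>act s z\<close> is at most as far from \<open>y\<close> as
        \<open>z\<close> is from \<open>y'\<close>. The ideal \<open>J\<close> depends only on
        \<open>z\<close>, so the closed ball around each \<open>y\<close> captures the limit
        set.\<close>
      have "limit_set z \<subseteq> {x \<in> K. q n (x - y) \<le> r}" if "y \<in> F" for y
      proof (rule limit_set_subset[OF J(1) ball[OF that]])
        fix s assume "s \<in> J"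
        obtain y' where y': "y' \<in> F" "y = act s y'"
          using surj[of s] \<open>y \<in> F\<close> by blast
        then have "q n (act s z - y) \<le> q n (z - y')"
          using J(2)[OF \<open>s \<in> J\<close>] \<open>F \<subseteq> M\<close> \<open>M \<subseteq> K\<close> by blast
        also have "\<dots> \<le> r"
          using z y' by (simp add: X_def)
        finally show "act s z \<in> {x \<in> K. q n (x - y) \<le> r}"
          using \<open>z \<in> K\<close> act_in[of z s] by (simp add: Y)
      qed
      moreover have "limit_set z \<subseteq> M"
        using M z by (auto simp: P_def X_def)
      ultimately show "limit_set z \<subseteq> X"
        by (auto simp: X_def)
    qed
    then have "X = M"
      by (intro min) (auto simp: X_def)
    then have "q n (a - b) \<le> r" if "a \<in> F" "b \<in> F" for a b
      using that \<open>F \<subseteq> M\<close> by (auto simp: X_def)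
    then have "d \<le> r"
      unfolding d_def using \<open>F \<noteq> {}\<close> by (intro cSUP_least) auto
    with \<open>r < d\<close> show False
      by simp
  qed
  obtain x0 where x0: "x0 \<in> F"
    using \<open>F \<noteq> {}\<close> by auto
  \<comment> \<open>Both points lie in \<open>F\<close>, all seminorms vanish on their difference,
    and the family separates points.\<close>
  have "act s x0 = x0" for s
    using surj[of s] x0 by (intro sep zero) auto
  with x0 \<open>F \<subseteq> M\<close> \<open>M \<subseteq> K\<close> show ?thesis
    by auto
qed

end
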